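(* Let $X$ be an infinite-dimensional Fréchet space and let $N \ge 1$ be an integer. Then the set $\mathcal{L}(X) \setminus \mathcal{SC}^N(X)$ is SOT-spaceable in $\mathcal{L}(X)$. In particular, if $X$ is a Banach space, this set is norm-spaceable, i.e. spaceable in $\mathcal{L}(X)$ with respect to the operator norm topology.
   Context: All topological vector spaces are Hausdorff and over the field $\mathbb{K} = \mathbb{R}$ or $\mathbb{C}$. A Fréchet space is a locally convex, complete, metrizable topological vector space. $\mathcal{L}(X)$ is the vector space of all continuous linear operators $X \to X$. For an integer $N \ge 1$, an operator $T \in \mathcal{L}(X)$ is $N$-supercyclic if there is an $N$-dimensional vector subspace $W \subset X$ such that $\bigcup_{n=0}^\infty T^n(W)$ is dense in $X$. $\mathcal{SC}^N(X)$ is the set of all $N$-supercyclic $T \in \mathcal{L}(X)$. The strong operator topology (SOT) on $\mathcal{L}(X)$ is the topology of pointwise convergence: a net $(T_\alpha)$ converges to $T$ iff $T_\alpha(x) \to T(x)$ in $X$ for every $x \in X$. A subset $A$ of a topological vector space $E$ is spaceable if there is a closed infinite-dimensional vector subspace $V \subset E$ with $V \subset A \cup \{0\}$; SOT-spaceable means spaceable in $E = \mathcal{L}(X)$ with the SOT. *)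

theory Defs
  imports "HOL-Analysis.Analysis" "HOL-Library.Function_Algebras"
begin

text \<open>
  The scalar field: every instance of this class is a copy of the reals or of the complex numbers,
  as a normed field.
\<close>

class real_or_complex = real_normed_field +
  assumes real_or_complex:
    "range (\<lambda>r. scaleR r 1) = UNIV \<or>
     (\<exists>\<phi> :: complex \<Rightarrow> 'a. bij \<phi> \<and>
        (\<forall>r. \<phi> (complex_of_real r) = scaleR r 1) \<and>
        (\<forall>z w. \<phi> (z + w) = \<phi> z + \<phi> w) \<and>
        (\<forall>z w. \<phi> (z * w) = \<phi> z * \<phi> w) \<and>
        (\<forall>z. norm (\<phi> z) = norm z))"

instance real :: real_or_complex
  by standard simp

instance complex :: real_or_complex
  by standard (rule disjI2, rule exI[where x = "\<lambda>z. z"], simp add: of_real_def bij_def)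

text \<open>
  Spaces are types; the scalar multiplication is an explicit parameter because the distribution has
  no class of complex vector spaces.  The multiplication by real scalars of class
  \<^class>\<open>real_vector\<close> is the restriction of the scalar multiplication, so that \<^const>\<open>convex\<close> has
  its usual meaning.  The uniform structure of a topological vector space is the translation
  invariant one: in \<^class>\<open>uniform_topological_group_add\<close>, \<^const>\<open>uniformity\<close> is
  \<^term>\<open>filtercomap (\<lambda>(x, y). y - x) (nhds 0)\<close> (the oddly named library lemma
  \<open>cauchy_seq_finset_iff_vanishing\<close>).  \<^const>\<open>complete\<close> is convergence of all Cauchy filters
  for it.
\<close>

locale tvs = vector_space scl
  for scl :: "'k::real_or_complex \<Rightarrow>
      'a::{real_vector, uniform_topological_group_add, t2_space} \<Rightarrow> 'a" +
  assumes scale_of_real: "scl (of_real r) x = r *\<^sub>R x"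
    and continuous_scale: "continuous_on UNIV (\<lambda>(c, x). scl c x)"

definition frechet_space ::
    "('k::real_or_complex \<Rightarrow>
      'a::{real_vector, uniform_topological_group_add, t2_space} \<Rightarrow> 'a) \<Rightarrow> bool" where
  "frechet_space scl \<longleftrightarrow>
     tvs scl \<and>
     (\<forall>U::'a set. open U \<and> 0 \<in> U \<longrightarrow> (\<exists>C. convex C \<and> C \<subseteq> U \<and> 0 \<in> interior C)) \<and>
     metrizable_space (euclidean :: 'a topology) \<and>
     complete (UNIV :: 'a set)"

locale banach_space = vector_space scl
  for scl :: "'k::real_or_complex \<Rightarrow> 'a::banach \<Rightarrow> 'a" +
  assumes scale_of_real: "scl (of_real r) x = r *\<^sub>R x"
    and norm_scale: "norm (scl c x) = norm c * norm x"

definition infinite_dim :: "('k::field \<Rightarrow> 'e::ab_group_add \<Rightarrow> 'e) \<Rightarrow> 'e set \<Rightarrow> bool" where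
  "infinite_dim scl V \<longleftrightarrow> \<not> (\<exists>B. finite B \<and> module.span scl B = V)"

text \<open>
  The ambient space is the topological space \<open>E\<close>, whose carrier \<^term>\<open>topspace E\<close> is a vector
  subspace of the type.
\<close>

definition spaceable ::
    "('k::field \<Rightarrow> 'e::ab_group_add \<Rightarrow> 'e) \<Rightarrow> 'e topology \<Rightarrow> 'e set \<Rightarrow> bool" where
  "spaceable scl E A \<longleftrightarrow>
     (\<exists>V. module.subspace scl V \<and> infinite_dim scl V \<and> closedin E V \<and> V \<subseteq> A \<union> {0})"

definition operators ::
    "('k::field \<Rightarrow> 'a::{ab_group_add, topological_space} \<Rightarrow> 'a) \<Rightarrow> ('a \<Rightarrow> 'a) set" where
  "operators scl = {T. Vector_Spaces.linear scl scl T \<and> continuous_on UNIV T}"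

text \<open>
  The existence of a finite basis is spelled out since \<^const>\<open>vector_space.dim\<close> is 0 for spaces
  of infinite dimension.
\<close>

definition supercyclic_operators ::
    "('k::field \<Rightarrow> 'a::{ab_group_add, topological_space} \<Rightarrow> 'a) \<Rightarrow> nat \<Rightarrow> ('a \<Rightarrow> 'a) set" where
  "supercyclic_operators scl N =
     {T \<in> operators scl.
        \<exists>W. (\<exists>B. finite B \<and> card B = N \<and> \<not> module.dependent scl B \<and> module.span scl B = W) \<and>
            closure (\<Union>n. (T ^^ n) ` W) = UNIV}"

definition op_scale :: "('k \<Rightarrow> 'a \<Rightarrow> 'a) \<Rightarrow> 'k \<Rightarrow> ('a \<Rightarrow> 'a) \<Rightarrow> 'a \<Rightarrow> 'a" where
  "op_scale scl c T = (\<lambda>x. scl c (T x))"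

definition strong_operator_topology ::
    "('k::field \<Rightarrow> 'a::{ab_group_add, topological_space} \<Rightarrow> 'a) \<Rightarrow> ('a \<Rightarrow> 'a) topology" where
  "strong_operator_topology scl =
     subtopology (product_topology (\<lambda>_. euclidean) UNIV) (operators scl)"

text \<open>
  The value 0 outside \<^term>\<open>operators scl\<close> is there because \<^locale>\<open>Metric_space\<close> requires a
  distance to be symmetric and nonnegative on the whole type.
\<close>

definition operator_norm_dist ::
    "('k::field \<Rightarrow> 'a::real_normed_vector \<Rightarrow> 'a) \<Rightarrow> ('a \<Rightarrow> 'a) \<Rightarrow> ('a \<Rightarrow> 'a) \<Rightarrow> real" where
  "operator_norm_dist scl S T =
     (if S \<in> operators scl \<and> T \<in> operators scl then onorm (\<lambda>x. S x - T x) else 0)"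

definition operator_norm_topology ::
    "('k::field \<Rightarrow> 'a::real_normed_vector \<Rightarrow> 'a) \<Rightarrow> ('a \<Rightarrow> 'a) topology" where
  "operator_norm_topology scl =
     Metric_space.mtopology (operators scl) (operator_norm_dist scl)"

text \<open>
  The library constants used above are only meaningful under the assumptions of their locales,
  which hold here.
\<close>

lemma vector_space_op_scale:
  assumes "vector_space scl"
  shows "vector_space (op_scale scl)"
proof -
  interpret vector_space scl by fact
  show ?thesis
    by standard (auto simp: op_scale_def fun_eq_iff scale_right_distrib scale_left_distrib)
qed

context banach_space
begin

lemma bounded_linear_operator:
  assumes "T \<in> operators scl"
  shows "bounded_linear T"
proof -
  interpret T: Vector_Spaces.linear scl scl T
    using assms by (simp add: operators_def)
  have lin: "linear T"
    by (rule linearI) (auto simp: T.add simp flip: scale_of_real intro: T.scale)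
  have "isCont T 0"
    using assms by (simp add: operators_def continuous_on_eq_continuous_at)
  then obtain d where d: "d > 0" "\<And>x. dist x 0 < d \<Longrightarrow> dist (T x) (T 0) < 1"
    unfolding continuous_at_eps_delta by (metis zero_less_one)
  have "norm (T x) \<le> norm x * (2 / d)" for x
  proof (cases "x = 0")
    case False
    define y where "y = (d / (2 * norm x)) *\<^sub>R x"
    have "norm y = d / 2"
      using False d(1) by (simp add: y_def)
    then have "norm (T y) < 1"
      using d by (simp add: T.zero)
    moreover have "T y = (d / (2 * norm x)) *\<^sub>R T x"
      by (simp add: y_def linear_scale[OF lin])
    ultimately show ?thesis
      using False d(1) by (simp add: field_simps)
  qed (simp add: T.zero)
  then show ?thesis
    by (intro bounded_linear_intro[where K = "2 / d"])
       (auto simp: linear_add[OF lin] linear_scale[OF lin])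
qed

lemma bounded_linear_operator_diff:
  assumes "S \<in> operators scl" "T \<in> operators scl"
  shows "bounded_linear (\<lambda>x. S x - T x)"
  using assms by (intro bounded_linear_sub bounded_linear_operator)

lemma Metric_space_operator_norm_dist:
  "Metric_space (operators scl) (operator_norm_dist scl)"
proof
  fix S T
  show "0 \<le> operator_norm_dist scl S T"
    by (auto simp: operator_norm_dist_def intro!: onorm_pos_le bounded_linear_operator_diff)
  have "onorm (\<lambda>x. S x - T x) = onorm (\<lambda>x. T x - S x)"
    by (subst onorm_neg[symmetric]) simp
  then show "operator_norm_dist scl S T = operator_norm_dist scl T S"
    by (simp add: operator_norm_dist_def)
next
  fix S T assume "S \<in> operators scl" "T \<in> operators scl"
  then show "operator_norm_dist scl S T = 0 \<longleftrightarrow> S = T"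
    by (simp add: operator_norm_dist_def onorm_eq_0[OF bounded_linear_operator_diff] fun_eq_iff)
next
  fix S T U
  assume "S \<in> operators scl" "T \<in> operators scl" "U \<in> operators scl"
  then show "operator_norm_dist scl S U \<le> operator_norm_dist scl S T + operator_norm_dist scl T U"
    using onorm_triangle[of "\<lambda>x. S x - T x" "\<lambda>x. T x - U x"]
    by (simp add: operator_norm_dist_def bounded_linear_operator_diff)
qed

end

text \<open>
  The second sort constraint is redundant: it holds for every \<^class>\<open>real_normed_vector\<close>, but the
  library does not declare the subclass relation.
\<close>

lemma banach_space_imp_frechet_space:
  fixes scl :: "'k::real_or_complex \<Rightarrow> 'a::{banach, uniform_topological_group_add} \<Rightarrow> 'a"
  assumes "banach_space scl"
  shows "frechet_space scl"
proof -
  interpret banach_space scl by fact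
  have "bounded_bilinear scl"
  proof
    show "\<exists>K. \<forall>a b. norm (scl a b) \<le> norm a * norm b * K"
      by (rule exI[where x = 1]) (simp add: norm_scale)
    show "scl (r *\<^sub>R a) b = r *\<^sub>R scl a b" for r a b
      unfolding scaleR_conv_of_real by (metis scale_of_real scale_scale)
    show "scl a (r *\<^sub>R b) = r *\<^sub>R scl a b" for r a b
      by (metis scale_of_real scale_left_commute)
  qed (simp_all only: scale_left_distrib scale_right_distrib)
  then have cont: "continuous_on UNIV (\<lambda>(c, x). scl c x)"
    unfolding case_prod_beta
    by (rule bounded_bilinear.continuous_on[OF _ continuous_on_fst continuous_on_snd])
       (rule continuous_on_id)+
  have "\<exists>C. convex C \<and> C \<subseteq> U \<and> 0 \<in> interior C" if "open U" "0 \<in> U" for U :: "'a set"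
  proof -
    obtain e where "e > 0" "ball 0 e \<subseteq> U"
      using \<open>open U\<close> \<open>0 \<in> U\<close> open_contains_ball by blast
    then show ?thesis
      by (intro exI[where x = "ball 0 e"]) simp
  qed
  moreover have "tvs scl"
    using cont by unfold_locales (simp_all add: scale_of_real)
  moreover have "metrizable_space (euclidean :: 'a topology)"
    using Met_TC.metrizable_space_mtopology by simp
  ultimately show ?thesis
    by (simp add: frechet_space_def complete_UNIV)
qed

end

theory Submission
  imports Defs
begin

text \<open>
  Fix \<open>e \<noteq> 0\<close> and let \<open>V\<close> be the space of the operators whose range lies in the line spanned by
  \<open>e\<close>.  For such an operator the orbit of a subspace \<open>W\<close> stays in \<open>W + span {e}\<close>, which is
  closed and proper when \<open>W\<close> has finite dimension; hence no element of \<open>V\<close> is supercyclic of any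
  order.  Since the line is closed, \<open>V\<close> is closed even for pointwise convergence.  It has infinite
  dimension because, by the Hahn-Banach theorem, the functionals \<open>f\<close> in the operators
  \<open>x \<mapsto> f x \<cdot> e\<close> separate the points of an infinite-dimensional space, which finitely many
  functionals cannot do.

  The Hahn-Banach theorem is obtained by applying Zorn's lemma to the sublinear functionals below a
  given one: the minimal ones are linear.
\<close>

section \<open>Sublinear functionals and the Hahn-Banach theorem\<close>

definition sublinear :: "('a::real_vector \<Rightarrow> real) \<Rightarrow> bool" where
  "sublinear p \<longleftrightarrow> (\<forall>x y. p (x + y) \<le> p x + p y) \<and> (\<forall>r\<ge>0. \<forall>x. p (r *\<^sub>R x) = r * p x)"

text \<open>One inequality suffices for positive homogeneity: for \<open>r > 0\<close> the reverse
  one is the same inequality for the scalar \<open>inverse r\<close> at the vector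
  \<open>r *\<^sub>R x\<close>.\<close>

lemma sublinearI:
  assumes add: "\<And>x y. p (x + y) \<le> p x + p y"
    and zero: "p 0 = 0"
    and scale: "\<And>r x. r > 0 \<Longrightarrow> p (r *\<^sub>R x) \<le> r * p x"
  shows "sublinear p"
proof -
  have "p (r *\<^sub>R x) = r * p x" if "r \<ge> 0" for r x
  proof (cases "r = 0")
    case False
    then have "r > 0" using that by simp
    then have "p x \<le> inverse r * p (r *\<^sub>R x)"
      using scale[of "inverse r" "r *\<^sub>R x"] by simp
    then have "r * p x \<le> p (r *\<^sub>R x)"
      using \<open>r > 0\<close> by (simp add: field_simps)
    then show ?thesis using scale[OF \<open>r > 0\<close>, of x] by simp
  qed (simp add: zero)
  then show ?thesis using add by (simp add: sublinear_def)
qed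

lemma sublinear_add: "sublinear p \<Longrightarrow> p (x + y) \<le> p x + p y"
  and sublinear_scale: "sublinear p \<Longrightarrow> r \<ge> 0 \<Longrightarrow> p (r *\<^sub>R x) = r * p x"
  by (simp_all add: sublinear_def)

lemma sublinear_0: "sublinear p \<Longrightarrow> p 0 = 0"
  using sublinear_scale[of p 0 0] by simp

lemma sublinear_minus: "sublinear p \<Longrightarrow> - p (- x) \<le> p x"
  using sublinear_add[of p x "- x"] sublinear_0[of p] by simp

text \<open>This yields the lower bounds of chains in Zorn's lemma. Subadditivity rests on
  comparability: if \<open>m\<close> is the smaller of \<open>q\<close> and \<open>q'\<close>, then
  \<open>m (x + y)\<close> is at most \<open>m x + m y\<close>, hence at most
  \<open>q x + q' y\<close>, and both infima can be taken independently.\<close>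

lemma sublinear_INF_chain:
  fixes C :: "('a::real_vector \<Rightarrow> real) set"
  assumes ne: "C \<noteq> {}"
    and sub: "\<And>q. q \<in> C \<Longrightarrow> sublinear q"
    and bdd: "\<And>x. bdd_below ((\<lambda>q. q x) ` C)"
    and chain: "\<And>q q'. q \<in> C \<Longrightarrow> q' \<in> C \<Longrightarrow> q \<le> q' \<or> q' \<le> q"
  shows "sublinear (\<lambda>x. INF q\<in>C. q x)"
proof (rule sublinearI)
  have lower: "(INF q\<in>C. q x) \<le> q x" if "q \<in> C" for q x
    using bdd that by (rule cINF_lower)
  fix x y
  have *: "(INF q\<in>C. q (x + y)) \<le> q x + q' y" if q: "q \<in> C" "q' \<in> C" for q q'
    using chain[OF q]
  proof
    assume "q \<le> q'"
    then have "q y \<le> q' y" by (rule le_funD)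
    then show ?thesis
      using lower[OF q(1), of "x + y"] sublinear_add[OF sub[OF q(1)], of x y] by linarith
  next
    assume "q' \<le> q"
    then have "q' x \<le> q x" by (rule le_funD)
    then show ?thesis
      using lower[OF q(2), of "x + y"] sublinear_add[OF sub[OF q(2)], of x y] by linarith
  qed
  have "(INF q\<in>C. q (x + y)) - q x \<le> (INF q\<in>C. q y)" if "q \<in> C" for q
    using ne *[OF that] by (intro cINF_greatest) (auto simp: algebra_simps)
  then have "(INF q\<in>C. q (x + y)) - (INF q\<in>C. q y) \<le> q x" if "q \<in> C" for q
    using that by (simp add: algebra_simps)
  then have "(INF q\<in>C. q (x + y)) - (INF q\<in>C. q y) \<le> (INF q\<in>C. q x)"
    using ne by (intro cINF_greatest) auto
  then show "(INF q\<in>C. q (x + y)) \<le> (INF q\<in>C. q x) + (INF q\<in>C. q y)" by simp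
next
  have "(INF q\<in>C. q 0) = (INF q\<in>C. 0)"
    by (intro INF_cong) (auto simp: sublinear_0 sub)
  then show "(INF q\<in>C. q 0) = 0" using ne by simp
next
  fix r :: real and x assume r: "r > 0"
  have "(INF q\<in>C. q (r *\<^sub>R x)) / r \<le> q x" if "q \<in> C" for q
    using cINF_lower[OF bdd that, of "r *\<^sub>R x"] r sublinear_scale[OF sub[OF that], of r x]
    by (simp add: field_simps)
  then have "(INF q\<in>C. q (r *\<^sub>R x)) / r \<le> (INF q\<in>C. q x)"
    using ne by (intro cINF_greatest) auto
  then show "(INF q\<in>C. q (r *\<^sub>R x)) \<le> r * (INF q\<in>C. q x)"
    using r by (simp add: field_simps)
qed

text \<open>
  For a minimal \<open>q\<close>, the functional \<open>q'\<close> obtained here equals \<open>q\<close>, so that \<open>q\<close> is also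
  superadditive.
\<close>

lemma sublinear_modification:
  assumes q: "sublinear q"
  obtains q' where "sublinear q'" "q' \<le> q" "\<And>y. q' y \<le> q (y + x) - q x"
proof
  \<comment> \<open>The parameter \<open>t = 0\<close> gives \<open>q' \<le> q\<close> and
    \<open>t = 1\<close> gives the last property. Letting \<open>t\<close> range over all
    nonnegative reals makes \<open>q'\<close> sublinear again: parameters add up under sums of
    vectors and are multiplied under scaling.\<close>
  define q' where "q' y = (INF t\<in>{0..}. q (y + t *\<^sub>R x) - t * q x)" for y
  have bdd: "bdd_below ((\<lambda>t. q (y + t *\<^sub>R x) - t * q x) ` {0..})" for y
  proof (rule bdd_belowI2[where m = "- q (- y)"])
    fix t :: real assume "t \<in> {0..}"
    then show "- q (- y) \<le> q (y + t *\<^sub>R x) - t * q x"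
      using sublinear_add[OF q, of "y + t *\<^sub>R x" "- y"] sublinear_scale[OF q, of t x] by simp
  qed
  have lower: "q' y \<le> q (y + t *\<^sub>R x) - t * q x" if "t \<ge> 0" for y t
    unfolding q'_def using that by (intro cINF_lower[OF bdd]) simp
  have greatest: "m \<le> q' y" if "\<And>t. t \<ge> 0 \<Longrightarrow> m \<le> q (y + t *\<^sub>R x) - t * q x" for m y
    unfolding q'_def using that by (intro cINF_greatest) auto
  show "q' \<le> q"
    using lower[of 0] by (simp add: le_fun_def)
  show "q' y \<le> q (y + x) - q x" for y
    using lower[of 1 y] by simp
  show "sublinear q'"
  proof (rule sublinearI)
    fix y z
    have *: "q' (y + z) \<le> (q (y + s *\<^sub>R x) - s * q x) + (q (z + t *\<^sub>R x) - t * q x)"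
      if "s \<ge> 0" "t \<ge> 0" for s t
      using lower[of "s + t" "y + z"] that
        sublinear_add[OF q, of "y + s *\<^sub>R x" "z + t *\<^sub>R x"]
      by (simp add: algebra_simps)
    have "q' (y + z) - (q (y + s *\<^sub>R x) - s * q x) \<le> q' z" if "s \<ge> 0" for s
      using *[OF that] by (intro greatest) (simp add: algebra_simps)
    then have "q' (y + z) - q' z \<le> q' y"
      by (intro greatest) (simp add: algebra_simps)
    then show "q' (y + z) \<le> q' y + q' z" by simp
  next
    have "0 \<le> q' 0"
      by (rule greatest) (simp add: sublinear_scale[OF q])
    then show "q' 0 = 0"
      using lower[of 0 0] by (simp add: sublinear_0[OF q])
  next
    fix r :: real and y assume r: "r > 0"
    have "q' (r *\<^sub>R y) / r \<le> q' y"
    proof (rule greatest)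
      fix t :: real assume "t \<ge> 0"
      then have "q' (r *\<^sub>R y) \<le> q (r *\<^sub>R (y + t *\<^sub>R x)) - (r * t) * q x"
        using lower[of "r * t" "r *\<^sub>R y"] r by (simp add: scaleR_right_distrib)
      also have "q (r *\<^sub>R (y + t *\<^sub>R x)) = r * q (y + t *\<^sub>R x)"
        using r by (simp only: sublinear_scale[OF q])
      finally have "q' (r *\<^sub>R y) \<le> r * (q (y + t *\<^sub>R x) - t * q x)"
        by (simp add: algebra_simps)
      then show "q' (r *\<^sub>R y) / r \<le> q (y + t *\<^sub>R x) - t * q x"
        using r by (simp add: divide_le_eq mult.commute)
    qed
    then show "q' (r *\<^sub>R y) \<le> r * q' y" using r by (simp add: field_simps)
  qed
qed

lemma sublinear_minimal_linear:
  assumes q: "sublinear q" and min: "\<And>q'. sublinear q' \<Longrightarrow> q' \<le> q \<Longrightarrow> q' = q"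
  shows "linear q"
proof -
  have add: "q (x + y) = q x + q y" for x y
  proof -
    obtain q' where "sublinear q'" "q' \<le> q" and q': "\<And>y. q' y \<le> q (y + x) - q x"
      using sublinear_modification[OF q, of x] by blast
    then have "q' = q" using min by blast
    then have "q y \<le> q (y + x) - q x" using q' by metis
    then show ?thesis using sublinear_add[OF q, of x y] by (simp add: add.commute)
  qed
  have neg: "q (- x) = - q x" for x
    using add[of x "- x"] sublinear_0[OF q] by simp
  have "q (r *\<^sub>R x) = r * q x" for r x
  proof (cases "r \<ge> 0")
    case False
    then show ?thesis
      using sublinear_scale[OF q, of "- r" x] neg[of "r *\<^sub>R x"] by simp
  qed (rule sublinear_scale[OF q])
  then show ?thesis using add by (intro linearI) simp_all
qed

theorem Hahn_Banach_sublinear: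
  assumes p: "sublinear p"
  obtains f where "linear f" "f \<le> p"
proof -
  define A where "A = {q. sublinear q \<and> q \<le> p}"
  \<comment> \<open>The order is reversed, so that the maximal element from Zorn's lemma is a
    minimal sublinear functional.\<close>
  define P where "P q q' \<longleftrightarrow> q' \<le> q" for q q' :: "'a \<Rightarrow> real"
  have "\<exists>m\<in>A. \<forall>a\<in>A. P m a \<longrightarrow> a = m"
  proof (rule predicate_Zorn)
    show "partial_order_on A (relation_of P A)"
      by (auto simp: partial_order_on_def preorder_on_def refl_on_def trans_def antisym_def
          relation_of_def P_def)
  next
    fix C assume "C \<in> Chains (relation_of P A)"
    then have C: "C \<subseteq> A" "\<And>q q'. q \<in> C \<Longrightarrow> q' \<in> C \<Longrightarrow> q \<le> q' \<or> q' \<le> q"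
      by (auto simp: Chains_def relation_of_def P_def)
    show "\<exists>u\<in>A. \<forall>a\<in>C. P a u"
    proof (cases "C = {}")
      case True
      then show ?thesis using p by (auto simp: A_def)
    next
      case False
      define u where "u x = (INF q\<in>C. q x)" for x
      \<comment> \<open>A bound common to all members: \<open>q x\<close> is at least
        \<open>- q (- x)\<close>, and \<open>q (- x)\<close> is at most
        \<open>p (- x)\<close>.\<close>
      have bdd: "bdd_below ((\<lambda>q. q x) ` C)" for x
      proof (rule bdd_belowI2[where m = "- p (- x)"])
        fix q assume "q \<in> C"
        then have "sublinear q" "q (- x) \<le> p (- x)"
          using C(1) by (auto simp: A_def le_fun_def)
        then show "- p (- x) \<le> q x" using sublinear_minus[of q x] by linarith
      qed
      have lower: "u \<le> q" if "q \<in> C" for q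
        unfolding le_fun_def u_def using cINF_lower[OF bdd that] by blast
      have "sublinear u"
        unfolding u_def using C False bdd by (intro sublinear_INF_chain) (auto simp: A_def)
      moreover obtain q where "q \<in> C" using False by blast
      then have "u \<le> p" using order_trans[OF lower, of q p] C(1) by (auto simp: A_def)
      ultimately show ?thesis using lower by (auto simp: A_def P_def)
    qed
  qed
  then obtain m where m: "m \<in> A" "\<And>a. a \<in> A \<Longrightarrow> a \<le> m \<Longrightarrow> a = m"
    by (auto simp: P_def)
  have "linear m"
  proof (rule sublinear_minimal_linear)
    show "q = m" if "sublinear q" "q \<le> m" for q
      using that m order_trans[of q m p] by (simp add: A_def)
  qed (use m(1) in \<open>simp add: A_def\<close>)
  with m(1) show thesis by (intro that) (auto simp: A_def)
qed

text \<open>A linear \<open>f\<close> is sought below the modification \<open>q\<close> of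
  \<open>p\<close> at \<open>x\<close> rather than below \<open>p\<close> itself. Then
  \<open>f (- x) \<le> q (- x) \<le> p 0 - p x = - p x\<close>, which forces \<open>f x\<close> up
  to \<open>p x\<close>.\<close>

corollary Hahn_Banach_sublinear_at:
  assumes p: "sublinear p"
  obtains f where "linear f" "f \<le> p" "f x = p x"
proof -
  obtain q where q: "sublinear q" "q \<le> p" "\<And>y. q y \<le> p (y + x) - p x"
    using sublinear_modification[OF p, of x] by blast
  obtain f where f: "linear f" "f \<le> q"
    using Hahn_Banach_sublinear[OF q(1)] by blast
  have "f (- x) \<le> - p x"
    using f(2) q(3)[of "- x"] sublinear_0[OF p] by (auto simp: le_fun_def dest: spec[of _ "- x"])
  then have "p x \<le> f x" using linear_neg[OF f(1), of x] by simp
  moreover have "f \<le> p" using f(2) q(2) by simp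
  ultimately have "f x = p x" by (simp add: le_fun_def antisym)
  with f(1) \<open>f \<le> p\<close> show thesis by (rule that)
qed

section \<open>Gauges of convex sets and continuous functionals\<close>

text \<open>The functional is the Minkowski gauge of \<open>C\<close>. If \<open>x / s\<close> and
  \<open>y / t\<close> lie in \<open>C\<close>, then \<open>(x + y) / (s + t)\<close> is their
  convex combination with weights \<open>s / (s + t)\<close> and \<open>t / (s + t)\<close>; this
  gives subadditivity.\<close>

lemma sublinear_gauge:
  fixes C :: "'a::real_vector set"
  assumes "convex C" and absorbing: "\<And>x. \<exists>t>0. inverse t *\<^sub>R x \<in> C"
  shows "sublinear (\<lambda>x. Inf {t. t > 0 \<and> inverse t *\<^sub>R x \<in> C})"
proof (rule sublinearI)
  define G where "G x = {t. t > 0 \<and> inverse t *\<^sub>R x \<in> C}" for x :: 'a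
  have bdd: "bdd_below (G x)" for x
    by (rule bdd_belowI[where m = 0]) (simp add: G_def)
  have ne: "G x \<noteq> {}" for x
    using absorbing[of x] by (auto simp: G_def)
  have add: "s + t \<in> G (x + y)" if st: "s \<in> G x" "t \<in> G y" for s t x y
  proof -
    have pos: "s > 0" "t > 0" using st by (auto simp: G_def)
    have "s / (s + t) + t / (s + t) = 1"
      using pos by (simp flip: add_divide_distrib)
    then have "(s / (s + t)) *\<^sub>R (inverse s *\<^sub>R x) + (t / (s + t)) *\<^sub>R (inverse t *\<^sub>R y) \<in> C"
      using st pos by (intro convexD[OF \<open>convex C\<close>]) (auto simp: G_def)
    moreover have "(s / (s + t)) *\<^sub>R (inverse s *\<^sub>R x) + (t / (s + t)) *\<^sub>R (inverse t *\<^sub>R y)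
        = inverse (s + t) *\<^sub>R (x + y)"
      using pos by (simp add: scaleR_right_distrib divide_simps)
    ultimately show ?thesis using pos by (simp add: G_def)
  qed
  fix x y
  have "Inf (G (x + y)) \<le> s + t" if "s \<in> G x" "t \<in> G y" for s t
    using cInf_lower[OF add[OF that] bdd] .
  then have "Inf (G (x + y)) - s \<le> Inf (G y)" if "s \<in> G x" for s
    using that by (intro cInf_greatest ne) (simp add: diff_le_eq add.commute[of _ s])
  then have "Inf (G (x + y)) - Inf (G y) \<le> Inf (G x)"
    by (intro cInf_greatest ne) (simp add: algebra_simps)
  then show "Inf {t. t > 0 \<and> inverse t *\<^sub>R (x + y) \<in> C}
    \<le> Inf {t. t > 0 \<and> inverse t *\<^sub>R x \<in> C} + Inf {t. t > 0 \<and> inverse t *\<^sub>R y \<in> C}"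
    by (simp add: G_def)
next
  have "0 \<in> C" using absorbing[of 0] by simp
  then have "{t::real. t > 0 \<and> inverse t *\<^sub>R 0 \<in> C} = {0<..}" by auto
  then show "Inf {t::real. t > 0 \<and> inverse t *\<^sub>R 0 \<in> C} = 0" by simp
next
  fix r :: real and x :: 'a assume r: "r > 0"
  let ?G = "\<lambda>x. {t. t > 0 \<and> inverse t *\<^sub>R x \<in> C}"
  have "Inf (?G (r *\<^sub>R x)) / r \<le> Inf (?G x)"
  proof (rule cInf_greatest)
    show "?G x \<noteq> {}" using absorbing[of x] by auto
    fix t assume "t \<in> ?G x"
    moreover have "inverse (r * t) * r = inverse t" using r by (simp add: field_simps)
    ultimately have "r * t \<in> ?G (r *\<^sub>R x)"
      using r by (simp del: inverse_mult_distrib)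
    then have "Inf (?G (r *\<^sub>R x)) \<le> r * t"
      by (rule cInf_lower) (rule bdd_belowI[where m = 0], simp)
    then show "Inf (?G (r *\<^sub>R x)) / r \<le> t" using r by (simp add: field_simps)
  qed
  then show "Inf (?G (r *\<^sub>R x)) \<le> r * Inf (?G x)" using r by (simp add: field_simps)
qed

text \<open>The one-sided bound controls the absolute value because it is applied to multiples of
  both \<open>y - x\<close> and \<open>x - y\<close>. The factor \<open>2 / e\<close> bounds the
  difference by \<open>e / 2\<close>, which leaves the strict inequality.\<close>

lemma linear_bounded_above_imp_continuous:
  fixes u :: "'a::{real_vector, topological_group_add} \<Rightarrow> real"
  assumes "linear u" and scale: "\<And>r::real. continuous_on UNIV (\<lambda>x::'a. r *\<^sub>R x)"
    and U: "open U" "0 \<in> U" "\<And>x. x \<in> U \<Longrightarrow> u x \<le> 1"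
  shows "continuous_on UNIV u"
  unfolding continuous_on_def
proof (intro ballI tendstoI)
  fix x and e :: real assume e: "e > 0"
  define V where "V = {y. (2 / e) *\<^sub>R (y - x) \<in> U} \<inter> {y. (2 / e) *\<^sub>R (x - y) \<in> U}"
  have 1: "continuous_on UNIV (\<lambda>y. (2 / e) *\<^sub>R (y - x))"
    by (rule continuous_on_compose2[OF scale]) (auto intro: continuous_intros)
  have 2: "continuous_on UNIV (\<lambda>y. (2 / e) *\<^sub>R (x - y))"
    by (rule continuous_on_compose2[OF scale]) (auto intro: continuous_intros)
  have "open V"
    unfolding V_def using open_vimage[OF U(1) 1] open_vimage[OF U(1) 2]
    by (auto simp: vimage_def)
  moreover have "x \<in> V" using U(2) by (simp add: V_def)
  moreover have "dist (u y) (u x) < e" if "y \<in> V" for y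
  proof -
    have "(2 / e) * (u y - u x) \<le> 1" "(2 / e) * (u x - u y) \<le> 1"
      using that U(3)[of "(2 / e) *\<^sub>R (y - x)"] U(3)[of "(2 / e) *\<^sub>R (x - y)"]
      by (simp_all add: V_def linear_scale[OF \<open>linear u\<close>] linear_diff[OF \<open>linear u\<close>])
    then show ?thesis using e by (simp add: dist_real_def field_simps abs_less_iff)
  qed
  ultimately show "eventually (\<lambda>y. dist (u y) (u x) < e) (at x within UNIV)"
    unfolding eventually_at_topological by blast
qed

text \<open>The common setting of both halves of the theorem; its sort constraint is met by the type
  of \<open>scaleX\<close> and by that of \<open>scaleB\<close>.\<close>

locale locally_convex_space = vector_space scl
  for scl :: "'k::real_or_complex \<Rightarrow>
      'a::{real_vector, topological_group_add, t2_space} \<Rightarrow> 'a" +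
  assumes scale_of_real: "scl (of_real r) x = r *\<^sub>R x"
    and continuous_scale: "continuous_on UNIV (\<lambda>(c, x). scl c x)"
    and locally_convex: "open (U :: 'a set) \<Longrightarrow> 0 \<in> U \<Longrightarrow> \<exists>C. convex C \<and> C \<subseteq> U \<and> 0 \<in> interior C"
begin

lemma continuous_on_scl [continuous_intros]:
  assumes "continuous_on S f" "continuous_on S g"
  shows "continuous_on S (\<lambda>x. scl (f x) (g x))"
  using continuous_on_compose2[OF continuous_scale continuous_on_Pair[OF assms]] by simp

text \<open>The gauge \<open>p\<close> of a convex neighbourhood \<open>C\<close> of 0 that misses
  \<open>x\<close> satisfies \<open>1 \<le> p x\<close>. Hahn-Banach gives \<open>u\<close> below
  \<open>p\<close> and equal to it at \<open>x\<close>; since \<open>p\<close> is at most 1 on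
  \<open>C\<close>, \<open>u\<close> is continuous.\<close>

lemma ex_real_functional:
  assumes "x \<noteq> 0"
  obtains u :: "'a \<Rightarrow> real" where "linear u" "continuous_on UNIV u" "u x \<noteq> 0"
proof -
  have cr: "continuous_on S (\<lambda>y. f y *\<^sub>R g y)"
    if "continuous_on S f" "continuous_on S g"
    for f and g :: "_ \<Rightarrow> 'a" and S :: "'z::topological_space set"
    using that by (simp flip: scale_of_real) (intro continuous_intros)
  obtain C where C: "convex C" "C \<subseteq> - {x}" "0 \<in> interior C"
    using locally_convex[of "- {x}"] assms by auto
  have "0 \<in> C" using C(3) interior_subset by blast
  define p where "p y = Inf {t. t > 0 \<and> inverse t *\<^sub>R y \<in> C}" for y
  have bdd: "bdd_below {t. t > 0 \<and> inverse t *\<^sub>R y \<in> C}" for y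
    by (rule bdd_belowI[where m = 0]) simp
  \<comment> \<open>Neighbourhoods of 0 are absorbing, since \<open>s *\<^sub>R y\<close> tends to 0
    with \<open>s\<close>.\<close>
  have abs: "\<exists>t>0. inverse t *\<^sub>R y \<in> C" for y
  proof -
    have "open ((\<lambda>s::real. s *\<^sub>R y) -` interior C)"
      by (rule open_vimage) (auto intro!: cr continuous_intros)
    moreover have "0 \<in> (\<lambda>s::real. s *\<^sub>R y) -` interior C" using C(3) by simp
    ultimately obtain e where "e > 0" "ball 0 e \<subseteq> (\<lambda>s::real. s *\<^sub>R y) -` interior C"
      using open_contains_ball by blast
    then have "(e / 2) *\<^sub>R y \<in> C"
      using interior_subset[of C] by (auto simp: subset_eq dest: spec[of _ "e / 2"])
    then show ?thesis using \<open>e > 0\<close> by (intro exI[of _ "2 / e"]) simp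
  qed
  have p: "sublinear p"
    unfolding p_def by (rule sublinear_gauge[OF C(1) abs])
  have "1 \<le> p x"
    unfolding p_def
  proof (rule cInf_greatest)
    show "{t. t > 0 \<and> inverse t *\<^sub>R x \<in> C} \<noteq> {}" using abs[of x] by auto
    fix t assume t: "t \<in> {t. t > 0 \<and> inverse t *\<^sub>R x \<in> C}"
    show "1 \<le> t"
    proof (rule ccontr)
      assume "\<not> 1 \<le> t"
      \<comment> \<open>For \<open>t < 1\<close> this convex combination of
        \<open>inverse t *\<^sub>R x\<close> and 0 is \<open>x\<close> itself, which
        \<open>C\<close> misses.\<close>
      then have "t *\<^sub>R (inverse t *\<^sub>R x) + (1 - t) *\<^sub>R 0 \<in> C"
        using t \<open>0 \<in> C\<close> by (intro convexD[OF C(1)]) auto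
      then show False using t C(2) by auto
    qed
  qed
  obtain u where u: "linear u" "u \<le> p" "u x = p x"
    using Hahn_Banach_sublinear_at[OF p] by blast
  have "p y \<le> 1" if "y \<in> C" for y
    unfolding p_def using that by (intro cInf_lower bdd) simp
  then have "u y \<le> 1" if "y \<in> interior C" for y
    using that interior_subset[of C] order_trans[OF le_funD[OF u(2), of y]] by blast
  then have "continuous_on UNIV u"
    using C(3) by (intro linear_bounded_above_imp_continuous[OF u(1), where U = "interior C"])
      (auto intro!: cr continuous_intros)
  then show thesis using u \<open>1 \<le> p x\<close> by (intro that) auto
qed

lemma ex_functional:
  assumes "x \<noteq> 0"
  obtains f where "Vector_Spaces.linear scl (*) f" "continuous_on UNIV f" "f x = 1"
proof -
  have vs: "vector_space ((*) :: 'k \<Rightarrow> 'k \<Rightarrow> 'k)"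
    by standard (auto simp: algebra_simps)
  obtain u :: "'a \<Rightarrow> real" where u: "linear u" "continuous_on UNIV u" "u x \<noteq> 0"
    using ex_real_functional[OF assms] by blast
  have "\<exists>f. Vector_Spaces.linear scl (*) f \<and> continuous_on UNIV f \<and> f x \<noteq> 0"
    using real_or_complex[where 'a = 'k]
  proof
    assume "range (\<lambda>r. scaleR r (1::'k)) = UNIV"
    then have real: "\<exists>r. c = of_real r" for c :: 'k
      unfolding of_real_def by (metis UNIV_I imageE)
    have "of_real (u (scl c y)) = c * of_real (u y)" for c y
      using real[of c] by (auto simp: scale_of_real linear_scale[OF u(1)])
    then have "Vector_Spaces.linear scl (*) (\<lambda>y. of_real (u y) :: 'k)"
      by (simp add: Vector_Spaces.linear_iff vs vector_space_axioms linear_add[OF u(1)])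
    then show ?thesis
      using u by (intro exI[of _ "\<lambda>y. of_real (u y)"]) (auto intro: continuous_intros)
  next
    assume "\<exists>\<phi> :: complex \<Rightarrow> 'k. bij \<phi> \<and>
        (\<forall>r. \<phi> (complex_of_real r) = scaleR r 1) \<and>
        (\<forall>z w. \<phi> (z + w) = \<phi> z + \<phi> w) \<and>
        (\<forall>z w. \<phi> (z * w) = \<phi> z * \<phi> w) \<and>
        (\<forall>z. norm (\<phi> z) = norm z)"
    then obtain \<phi> :: "complex \<Rightarrow> 'k" where \<phi>: "bij \<phi>"
        "\<And>r. \<phi> (complex_of_real r) = of_real r" "\<And>z w. \<phi> (z + w) = \<phi> z + \<phi> w"
        "\<And>z w. \<phi> (z * w) = \<phi> z * \<phi> w" "\<And>z. norm (\<phi> z) = norm z"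
      by (auto simp: of_real_def)
    \<comment> \<open>The imaginary unit of \<open>'k\<close>.\<close>
    define j where "j = \<phi> \<i>"
    have jj: "j * j = - 1"
      using \<phi>(2)[of "- 1"] by (simp add: j_def flip: \<phi>(4))
    have ex: "\<exists>a b. c = of_real a + of_real b * j" for c
    proof -
      obtain z where "c = \<phi> z" using \<phi>(1) by (metis bij_pointE)
      then have "c = \<phi> (complex_of_real (Re z) + \<i> * complex_of_real (Im z))"
        by (simp flip: complex_eq)
      then have "c = of_real (Re z) + of_real (Im z) * j"
        by (simp only: \<phi> j_def mult.commute)
      then show ?thesis by blast
    qed
    \<comment> \<open>The usual complexification of a real functional: it commutes with real scalars
      and with \<open>j\<close>, hence with all scalars.\<close>
    define f where "f y = of_real (u y) - j * of_real (u (scl j y))" for y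
    have add: "f (y + z) = f y + f z" for y z
      by (simp add: f_def scale_right_distrib linear_add[OF u(1)] algebra_simps)
    have f_real: "f (scl (of_real r) y) = of_real r * f y" for r y
    proof -
      have "scl j (scl (of_real r) y) = r *\<^sub>R scl j y"
        by (metis scale_left_commute scale_of_real)
      then show ?thesis
        unfolding f_def
        by (simp only: scale_of_real linear_scale[OF u(1)]) (simp add: algebra_simps)
    qed
    have f_j: "f (scl j y) = j * f y" for y
    proof -
      have "scl j (scl j y) = - y" by (simp add: jj)
      then have "f (scl j y) = of_real (u (scl j y)) + j * of_real (u y)"
        by (simp add: f_def linear_neg[OF u(1)])
      also have "\<dots> = j * of_real (u y) - (j * j) * of_real (u (scl j y))"
        by (simp add: jj)
      finally show ?thesis by (simp add: f_def algebra_simps)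
    qed
    have "f (scl c y) = c * f y" for c y
    proof -
      obtain a b where c: "c = of_real a + of_real b * j" using ex by blast
      have "scl c y = scl (of_real a) y + scl (of_real b) (scl j y)"
        by (simp add: c scale_left_distrib)
      then show ?thesis
        by (simp only: add f_real f_j) (simp add: c algebra_simps)
    qed
    then have "Vector_Spaces.linear scl (*) f"
      by (simp add: Vector_Spaces.linear_iff vs vector_space_axioms add)
    moreover have "continuous_on UNIV f"
      unfolding f_def
      by (intro continuous_intros continuous_on_compose2[OF u(2)]) (auto intro: u(2))
    moreover have "f x \<noteq> 0"
    proof
      assume "f x = 0"
      \<comment> \<open>This exhibits \<open>u x\<close> as the real part of the number
        corresponding to \<open>f x\<close>. As \<open>\<phi>\<close> preserves norms,
        \<open>f x = 0\<close> would force \<open>u x = 0\<close>.\<close>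
      moreover have "\<phi> (complex_of_real (u x) + \<i> * complex_of_real (- u (scl j x))) = f x"
        by (simp only: \<phi>) (simp add: f_def j_def)
      ultimately have "norm (complex_of_real (u x) + \<i> * complex_of_real (- u (scl j x))) = 0"
        by (metis \<phi>(5) norm_zero)
      then have "u x = 0" by (simp add: complex_eq_iff)
      then show False using u(3) by simp
    qed
    ultimately show ?thesis by blast
  qed
  then obtain f where f: "Vector_Spaces.linear scl (*) f" "continuous_on UNIV f" "f x \<noteq> 0"
    by blast
  have "Vector_Spaces.linear scl (*) (\<lambda>y. f y / f x)"
    using f(1) by (simp add: Vector_Spaces.linear_iff add_divide_distrib)
  moreover have "continuous_on UNIV (\<lambda>y. f y / f x)"
    using f by (intro continuous_intros) auto
  ultimately show thesis
    by (rule that) (use f(3) in simp)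
qed

section \<open>Continuous operators and finite-dimensional subspaces\<close>

lemma rank_one_operator:
  assumes f: "Vector_Spaces.linear scl (*) f" "continuous_on UNIV f"
  shows "(\<lambda>x. scl (f x) v) \<in> operators scl"
  using f unfolding operators_def Vector_Spaces.linear_iff
  by (auto simp: scale_left_distrib intro!: continuous_intros)

lemma operators_compose:
  "S \<in> operators scl \<Longrightarrow> T \<in> operators scl \<Longrightarrow> (\<lambda>x. S (T x)) \<in> operators scl"
  unfolding operators_def Vector_Spaces.linear_iff by (auto intro: continuous_on_compose2)

lemma operators_add:
  "S \<in> operators scl \<Longrightarrow> T \<in> operators scl \<Longrightarrow> (\<lambda>x. S x + T x) \<in> operators scl"
  unfolding operators_def Vector_Spaces.linear_iff
  by (auto simp: scale_right_distrib algebra_simps intro!: continuous_intros)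

lemma operators_scale: "T \<in> operators scl \<Longrightarrow> (\<lambda>x. scl c (T x)) \<in> operators scl"
  unfolding operators_def Vector_Spaces.linear_iff
  by (auto simp: scale_right_distrib mult.commute intro!: continuous_intros)

lemma operators_zero: "(\<lambda>x. 0) \<in> operators scl"
  unfolding operators_def Vector_Spaces.linear_iff using vector_space_axioms by auto

lemma operators_id: "(\<lambda>x. x) \<in> operators scl"
  unfolding operators_def Vector_Spaces.linear_iff using vector_space_axioms by auto

lemma operators_diff:
  assumes "S \<in> operators scl" "T \<in> operators scl"
  shows "(\<lambda>x. S x - T x) \<in> operators scl"
  using operators_add[OF assms(1) operators_scale[OF assms(2), of "- 1"]] by simp

text \<open>By induction on the spanning set. A new vector \<open>b\<close> outside the span is
  replaced by \<open>y = b - P b\<close>, and a functional \<open>g\<close> with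
  \<open>g y = 1\<close> corrects \<open>P\<close> in the direction \<open>y\<close>.\<close>

lemma continuous_projection:
  assumes "finite B"
  shows "\<exists>P \<in> operators scl. range P \<subseteq> span B \<and> (\<forall>x\<in>span B. P x = x)"
  using assms
proof (induction B rule: finite_induct)
  case empty
  then show ?case using operators_zero by (intro bexI[of _ "\<lambda>x. 0"]) auto
next
  case (insert b B)
  then obtain P where P: "P \<in> operators scl" "\<And>x. P x \<in> span B" "\<And>x. x \<in> span B \<Longrightarrow> P x = x"
    by auto
  show ?case
  proof (cases "b \<in> span B")
    case True
    then show ?thesis using P by (intro bexI[of _ P]) (auto simp: span_redundant)
  next
    case False
    define y where "y = b - P b"
    have "y \<noteq> 0" using False P(2)[of b] by (auto simp: y_def)
    then obtain g where g: "Vector_Spaces.linear scl (*) g" "continuous_on UNIV g" "g y = 1"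
      using ex_functional by blast
    \<comment> \<open>Evaluating \<open>g\<close> at \<open>x - P x\<close> instead of
      \<open>x\<close> makes the correction vanish on \<open>span B\<close>; at \<open>b\<close> it
      adds exactly \<open>y\<close>, so that \<open>Q b = P b + y = b\<close>.\<close>
    define Q where "Q x = P x + scl (g (x - P x)) y" for x
    have Q: "Q \<in> operators scl"
      unfolding Q_def
      by (intro operators_add P(1) operators_compose[OF rank_one_operator[OF g(1,2)]]
          operators_diff[OF operators_id])
    have sub: "span B \<subseteq> span (insert b B)" by (intro span_mono) auto
    have "y \<in> span (insert b B)"
      unfolding y_def using P(2)[of b] sub by (intro span_diff) (auto intro: span_base)
    then have range: "Q x \<in> span (insert b B)" for x
      unfolding Q_def using P(2)[of x] sub by (intro span_add span_scale) auto
    interpret Q: Vector_Spaces.linear scl scl Q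
      using Q by (simp add: operators_def)
    have "g 0 = 0"
      using g(1) unfolding Vector_Spaces.linear_iff by (metis mult_zero_left scale_zero_left)
    then have "Q x = x" if "x \<in> B" for x
      using P(3)[of x] that by (simp add: Q_def span_base)
    moreover have "Q b = b" using g(3) by (simp add: Q_def flip: y_def) (simp add: y_def)
    ultimately have base: "Q x = x" if "x \<in> insert b B" for x using that by blast
    have "Q x = x" if "x \<in> span (insert b B)" for x
      using that by (induction rule: span_induct_alt) (simp_all add: Q.zero Q.add Q.scale base)
    then show ?thesis using Q range by (intro bexI[of _ Q]) auto
  qed
qed

text \<open>The span is the fixed point set of a continuous projection, and such a set is closed in
  a Hausdorff space.\<close>

lemma closed_span_finite:
  assumes "finite B"
  shows "closed (span B)"
proof -
  obtain P where P: "P \<in> operators scl" "range P \<subseteq> span B" "\<forall>x\<in>span B. P x = x"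
    using continuous_projection[OF assms] by blast
  then have "span B = {x. P x = x}"
    by (metis (mono_tags, lifting) Collect_cong Collect_mem_eq range_subsetD)
  moreover have "closed {x. P x = x}"
    using P(1) by (intro closed_Collect_eq) (auto simp: operators_def intro: continuous_intros)
  ultimately show ?thesis by simp
qed

end

section \<open>Common kernels of finitely many functionals\<close>

text \<open>Each further functional \<open>g\<close> costs at most one further vector. Either
  \<open>g\<close> already vanishes on the common kernel of \<open>F\<close>, and \<open>B\<close>
  still works, or some \<open>v\<close> in that kernel has \<open>g v \<noteq> 0\<close> and is
  added to \<open>B\<close>.\<close>

lemma (in vector_space) span_plus_common_kernel:
  assumes "finite F" "\<And>f. f \<in> F \<Longrightarrow> Vector_Spaces.linear scale (*) f"
  shows "\<exists>B. finite B \<and> (\<forall>x. \<exists>b\<in>span B. \<forall>f\<in>F. f (x - b) = 0)"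
  using assms
proof (induction F rule: finite_induct)
  case empty
  then show ?case by (intro exI[of _ "{}"]) auto
next
  case (insert g F)
  then obtain B where B: "finite B" "\<And>x. \<exists>b\<in>span B. \<forall>f\<in>F. f (x - b) = 0" by auto
  show ?case
  proof (cases "\<exists>v. (\<forall>f\<in>F. f v = 0) \<and> g v \<noteq> 0")
    case False
    then have "\<exists>b\<in>span B. \<forall>f\<in>insert g F. f (x - b) = 0" for x using B(2)[of x] by blast
    then show ?thesis using B(1) by blast
  next
    case True
    then obtain v where v: "\<And>f. f \<in> F \<Longrightarrow> f v = 0" "g v \<noteq> 0" by blast
    have lin: "f (x - y) = f x - f y" "f (scale c x) = c * f x" if "f \<in> insert g F" for f c x y
    proof -
      interpret f: Vector_Spaces.linear scale "(*)" f using insert.prems that by blast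
      show "f (x - y) = f x - f y" by (rule f.diff)
      show "f (scale c x) = c * f x" by (rule f.scale)
    qed
    have "\<exists>b\<in>span (insert v B). \<forall>f\<in>insert g F. f (x - b) = 0" for x
    proof -
      obtain b where b: "b \<in> span B" "\<And>f. f \<in> F \<Longrightarrow> f (x - b) = 0" using B(2)[of x] by blast
      \<comment> \<open>The coefficient of \<open>v\<close> cancels \<open>g (x - b)\<close>; the
        values of the functionals in \<open>F\<close> do not change, as they vanish at
        \<open>v\<close>.\<close>
      define b' where "b' = b + scale (g (x - b) / g v) v"
      have eq: "x - b' = (x - b) - scale (g (x - b) / g v) v"
        by (simp add: b'_def algebra_simps)
      have "b \<in> span (insert v B)" using b(1) span_mono[of B "insert v B"] by auto
      then have "b' \<in> span (insert v B)"
        unfolding b'_def by (intro span_add span_scale) (auto intro: span_base)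
      moreover have "f (x - b') = 0" if "f \<in> insert g F" for f
      proof -
        have "f (x - b') = f (x - b) - (g (x - b) / g v) * f v"
          unfolding eq by (simp only: lin[OF that])
        then show ?thesis using that v(1)[of f] v(2) b(2)[of f] by (cases "f = g") auto
      qed
      ultimately show ?thesis by blast
    qed
    then show ?thesis using B(1) by (intro exI[of _ "insert v B"]) auto
  qed
qed

lemma (in vector_space) common_kernel_nontrivial:
  assumes "infinite_dim scale UNIV"
    and "finite F" "\<And>f. f \<in> F \<Longrightarrow> Vector_Spaces.linear scale (*) f"
  obtains x where "x \<noteq> 0" "\<And>f. f \<in> F \<Longrightarrow> f x = 0"
proof -
  obtain B where B: "finite B" "\<And>x. \<exists>b\<in>span B. \<forall>f\<in>F. f (x - b) = 0"
    using span_plus_common_kernel[OF assms(2,3)] by blast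
  obtain y where "y \<notin> span B" using assms(1) B(1) by (auto simp: infinite_dim_def)
  moreover obtain b where "b \<in> span B" "\<forall>f\<in>F. f (y - b) = 0" using B(2) by blast
  ultimately show thesis using that[of "y - b"] by auto
qed

section \<open>Operators with range in a line\<close>

context locally_convex_space
begin

lemma not_supercyclic_finite_rank:
  assumes inf: "infinite_dim scl UNIV" and E: "finite E" "range T \<subseteq> span E"
  shows "T \<notin> supercyclic_operators scl N"
proof
  assume "T \<in> supercyclic_operators scl N"
  then obtain B where B: "finite B" and dense: "closure (\<Union>n. (T ^^ n) ` span B) = UNIV"
    by (auto simp: supercyclic_operators_def)
  \<comment> \<open>The power 0 accounts for \<open>B\<close>; every later power maps into the range
    of \<open>T\<close>, which accounts for \<open>E\<close>.\<close>
  have "(T ^^ n) ` span B \<subseteq> span (B \<union> E)" for n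
  proof (cases n)
    case 0
    then show ?thesis using span_mono[of B "B \<union> E"] by auto
  next
    case (Suc m)
    then have "(T ^^ n) ` span B \<subseteq> range T" by auto
    also have "\<dots> \<subseteq> span (B \<union> E)" using E(2) span_mono[of E "B \<union> E"] by auto
    finally show ?thesis .
  qed
  then have "closure (\<Union>n. (T ^^ n) ` span B) \<subseteq> span (B \<union> E)"
    using B E(1) by (intro closure_minimal closed_span_finite) auto
  then show False using inf dense B E(1) by (auto simp: infinite_dim_def)
qed

lemma subspace_operators_into:
  assumes "subspace S"
  shows "module.subspace (op_scale scl) {T \<in> operators scl. range T \<subseteq> S}"
proof -
  interpret op: vector_space "op_scale scl"
    by (rule vector_space_op_scale) (rule vector_space_axioms)
  show ?thesis
    using assms operators_zero operators_add operators_scale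
    by (auto simp: op.subspace_def subspace_def op_scale_def zero_fun_def plus_fun_def
        image_subset_iff)
qed

text \<open>If a finite \<open>F\<close> spanned the space, all its members would vanish at a common
  \<open>x \<noteq> 0\<close>, and so would their combinations. The rank one operator built from a
  functional \<open>h\<close> with \<open>h x = 1\<close> does not.\<close>

lemma infinite_dim_operators_into_line:
  assumes inf: "infinite_dim scl UNIV" and "e \<noteq> 0"
  shows "infinite_dim (op_scale scl) {T \<in> operators scl. range T \<subseteq> span {e}}"
  unfolding infinite_dim_def
proof
  interpret op: vector_space "op_scale scl"
    by (rule vector_space_op_scale) (rule vector_space_axioms)
  assume "\<exists>F. finite F \<and> op.span F = {T \<in> operators scl. range T \<subseteq> span {e}}"
  then obtain F where F: "finite F" "op.span F = {T \<in> operators scl. range T \<subseteq> span {e}}"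
    by blast
  \<comment> \<open>\<open>g\<close> reads off the coefficient of \<open>e\<close>, so an operator
    \<open>T\<close> into the line vanishes wherever the functional \<open>g (T x)\<close>
    does.\<close>
  obtain g where g: "Vector_Spaces.linear scl (*) g" "g e = 1"
    using ex_functional[OF \<open>e \<noteq> 0\<close>] by blast
  have T: "T \<in> operators scl" "range T \<subseteq> span {e}" if "T \<in> F" for T
    using op.span_base[OF that] by (simp_all add: F(2))
  have lin: "Vector_Spaces.linear scl (*) (\<lambda>x. g (T x))" if "T \<in> F" for T
    using T(1)[OF that] g(1) unfolding operators_def Vector_Spaces.linear_iff by simp
  obtain x where x: "x \<noteq> 0" "\<And>f. f \<in> (\<lambda>T x. g (T x)) ` F \<Longrightarrow> f x = 0"
    by (rule common_kernel_nontrivial[OF inf, of "(\<lambda>T x. g (T x)) ` F"])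
      (use F(1) lin in \<open>auto\<close>)
  have F0: "T x = 0" if "T \<in> F" for T
  proof -
    have "T x \<in> span {e}" using T(2)[OF that] by blast
    then obtain c where c: "T x = scl c e" by (auto simp: span_singleton)
    have "g (T x) = 0" using x(2)[OF imageI[OF that]] .
    moreover have "g (T x) = c * g e"
      using g(1) unfolding c Vector_Spaces.linear_iff by blast
    ultimately show ?thesis using g(2) c by simp
  qed
  have zero: "T x = 0" if "T \<in> op.span F" for T
    using that by (induction rule: op.span_induct_alt) (simp_all add: op_scale_def F0)
  obtain h where h: "Vector_Spaces.linear scl (*) h" "continuous_on UNIV h" "h x = 1"
    using ex_functional[OF x(1)] by blast
  have "(\<lambda>x. scl (h x) e) \<in> op.span F"
    unfolding F(2) using rank_one_operator[OF h(1,2)] by (auto simp: span_singleton)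
  from zero[OF this] show False using h(3) \<open>e \<noteq> 0\<close> by simp
qed

text \<open>The topology \<open>E\<close> enters only through the hypothesis \<open>closed\<close>,
  which is verified below for the strong and for the norm topology.\<close>

lemma spaceable_non_supercyclic:
  assumes inf: "infinite_dim scl UNIV"
    and closed: "\<And>S. closed S \<Longrightarrow> closedin E {T \<in> operators scl. range T \<subseteq> S}"
  shows "spaceable (op_scale scl) E (operators scl - supercyclic_operators scl N)"
proof -
  \<comment> \<open>The empty set spans the zero space, so infinite dimension provides a nonzero
    vector.\<close>
  have "span {} \<noteq> UNIV" using inf unfolding infinite_dim_def by blast
  then have "\<exists>e::'a. e \<noteq> 0" by auto
  then obtain e :: 'a where "e \<noteq> 0" by blast
  have "{T \<in> operators scl. range T \<subseteq> span {e}} \<subseteq> operators scl - supercyclic_operators scl N"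
    using not_supercyclic_finite_rank[OF inf, of "{e}"] by blast
  then show ?thesis
    unfolding spaceable_def
    using subspace_operators_into[OF subspace_span]
      infinite_dim_operators_into_line[OF inf \<open>e \<noteq> 0\<close>] closed[OF closed_span_finite[of "{e}"]]
    by (intro exI[of _ "{T \<in> operators scl. range T \<subseteq> span {e}}"] conjI) (assumption | blast)+
qed

end

section \<open>Closedness in the strong and in the norm topology\<close>

text \<open>The range condition cuts out a product of copies of \<open>S\<close>, which is closed
  for pointwise convergence.\<close>

lemma closedin_strong_operator_topology_range:
  assumes "closed S"
  shows "closedin (strong_operator_topology scl) {T \<in> operators scl. range T \<subseteq> S}"
proof -
  have "closedin (product_topology (\<lambda>_. euclidean) UNIV) (PiE UNIV (\<lambda>_. S))"
    using assms by (simp add: closedin_product_topology)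
  moreover have "{T \<in> operators scl. range T \<subseteq> S} = operators scl \<inter> PiE UNIV (\<lambda>_. S)"
    by (auto simp: PiE_def)
  ultimately show ?thesis
    unfolding strong_operator_topology_def by (auto simp: closedin_subtopology)
qed

text \<open>Evaluation at \<open>x\<close> is Lipschitz for the operator norm distance with constant
  \<open>norm x\<close>. If \<open>T x\<close> lies outside \<open>S\<close>, so does
  \<open>T' x\<close> for all \<open>T'\<close> in a small ball around \<open>T\<close>.\<close>

lemma (in banach_space) closedin_operator_norm_topology_range:
  assumes "closed S"
  shows "closedin (operator_norm_topology scl) {T \<in> operators scl. range T \<subseteq> S}"
proof -
  interpret M: Metric_space "operators scl" "operator_norm_dist scl"
    by (rule Metric_space_operator_norm_dist)
  have "\<exists>r>0. disjnt {T \<in> operators scl. range T \<subseteq> S} (M.mball T r)"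
    if T: "T \<in> operators scl" "T x \<notin> S" for T x
  proof -
    obtain e where e: "e > 0" "ball (T x) e \<subseteq> - S"
      using T(2) assms open_contains_ball[of "- S"] by auto
    \<comment> \<open>The summand 1 keeps the denominator positive for \<open>x = 0\<close> and
      makes \<open>r * norm x < e\<close> strict.\<close>
    define r where "r = e / (norm x + 1)"
    have "T' x \<notin> S" if "T' \<in> M.mball T r" for T'
    proof -
      have T': "T' \<in> operators scl" "operator_norm_dist scl T T' < r" using that by auto
      have "dist (T x) (T' x) \<le> onorm (\<lambda>x. T x - T' x) * norm x"
        unfolding dist_norm using T(1) T'(1) by (intro onorm bounded_linear_operator_diff)
      also have "\<dots> \<le> r * norm x"
        using T(1) T' by (intro mult_right_mono) (auto simp: operator_norm_dist_def)
      also have "\<dots> < e"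
      proof -
        have "norm x + 1 > 0" using norm_ge_zero[of x] by linarith
        then show ?thesis using e(1) by (simp add: r_def field_simps)
      qed
      finally show ?thesis using e(2) by auto
    qed
    moreover have "r > 0" using e(1) norm_ge_zero[of x] by (simp add: r_def add_nonneg_pos)
    ultimately show ?thesis by (intro exI[of _ r]) (auto simp: disjnt_iff)
  qed
  then show ?thesis
    unfolding operator_norm_topology_def M.closedin_metric by blast
qed

section \<open>Banach and Frechet spaces as locally convex spaces, and the conclusion\<close>

lemma (in banach_space) bounded_bilinear_scale: "bounded_bilinear scl"
proof
  show "\<exists>K. \<forall>a b. norm (scl a b) \<le> norm a * norm b * K"
    by (rule exI[where x = 1]) (simp add: norm_scale)
  show "scl (r *\<^sub>R a) b = r *\<^sub>R scl a b" for r a b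
    unfolding scaleR_conv_of_real by (metis scale_of_real scale_scale)
  show "scl a (r *\<^sub>R b) = r *\<^sub>R scl a b" for r a b
    by (metis scale_of_real scale_left_commute)
qed (simp_all only: scale_left_distrib scale_right_distrib)

lemma (in banach_space) locally_convex_space_scale: "locally_convex_space scl"
proof
  show "scl (of_real r) x = r *\<^sub>R x" for r x
    by (rule scale_of_real)
  show "continuous_on UNIV (\<lambda>(c, x). scl c x)"
    unfolding case_prod_beta
    by (intro bounded_bilinear.continuous_on[OF bounded_bilinear_scale] continuous_on_fst
        continuous_on_snd continuous_on_id)
  show "\<exists>C. convex C \<and> C \<subseteq> U \<and> 0 \<in> interior C" if U: "open U" "0 \<in> U" for U :: "'a set"
  proof -
    obtain e where "e > 0" "ball 0 e \<subseteq> U"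
      using openE[OF U] .
    then have "convex (ball 0 e :: 'a set) \<and> ball 0 e \<subseteq> U \<and> 0 \<in> interior (ball 0 e :: 'a set)"
      by simp
    then show ?thesis ..
  qed
qed

lemma frechet_space_imp_locally_convex_space:
  fixes scl :: "'k::real_or_complex \<Rightarrow>
      'a::{real_vector, uniform_topological_group_add, t2_space} \<Rightarrow> 'a"
  assumes "frechet_space scl"
  shows "locally_convex_space scl"
proof -
  interpret tvs scl using assms by (simp add: frechet_space_def)
  show ?thesis
  proof
    show "\<exists>C. convex C \<and> C \<subseteq> U \<and> 0 \<in> interior C" if "open U" "0 \<in> U" for U :: "'a set"
      using assms that by (simp add: frechet_space_def)
  qed (rule scale_of_real continuous_scale)+
qed

theorem theorem5p2:
  fixes scaleX :: "'k::real_or_complex \<Rightarrow>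
      'x::{real_vector, uniform_topological_group_add, t2_space} \<Rightarrow> 'x"
    and scaleB :: "'k \<Rightarrow> 'b::banach \<Rightarrow> 'b"
    and N :: nat
  assumes "N \<ge> 1"
  shows
    "(frechet_space scaleX \<and> infinite_dim scaleX UNIV \<longrightarrow>
        spaceable (op_scale scaleX) (strong_operator_topology scaleX)
          (operators scaleX - supercyclic_operators scaleX N)) \<and>
     (banach_space scaleB \<and> infinite_dim scaleB UNIV \<longrightarrow>
        spaceable (op_scale scaleB) (operator_norm_topology scaleB)
          (operators scaleB - supercyclic_operators scaleB N))"
proof (intro conjI impI; elim conjE)
  assume "frechet_space scaleX" "infinite_dim scaleX UNIV"
  then show "spaceable (op_scale scaleX) (strong_operator_topology scaleX)
      (operators scaleX - supercyclic_operators scaleX N)"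
    by (intro locally_convex_space.spaceable_non_supercyclic
        frechet_space_imp_locally_convex_space closedin_strong_operator_topology_range)
next
  assume "banach_space scaleB" "infinite_dim scaleB UNIV"
  then show "spaceable (op_scale scaleB) (operator_norm_topology scaleB)
      (operators scaleB - supercyclic_operators scaleB N)"
    by (intro locally_convex_space.spaceable_non_supercyclic
        banach_space.locally_convex_space_scale
        banach_space.closedin_operator_norm_topology_range)
qed

end
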